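(* Let $N = p^k m^2$ be an odd perfect number, where $p$ is a prime with $p \equiv k \equiv 1 \pmod 4$, $k$ a positive integer, $m$ a positive integer and $\gcd(p,m)=1$. Set $$\rho_1 = \frac{\sigma(p^k)}{p^k},\quad \rho_2 = \frac{\sigma(p^k)}{m^2},\quad \mu_1 = \frac{\sigma(m^2)}{m^2},\quad \mu_2 = \frac{\sigma(m^2)}{p^k}.$$ Then $$0 < \rho_2 \le \frac{2}{3} < 1 < \rho_1 < \frac{5}{4} < \frac{8}{5} < \mu_1 < 2 < 3 \le \mu_2$$ and $$\frac{57}{20} < \rho_1 + \mu_1 < 3 < \frac{11}{3} \le \rho_2 + \mu_2.$$
   Context: $\sigma(n)$ denotes the sum of the positive divisors of $n$. An odd perfect number is an odd positive integer $N$ with $\sigma(N)=2N$. *)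

theory Defs
  imports Complex_Main "HOL-Number_Theory.Number_Theory"
begin

definition divisor_sum :: "nat \<Rightarrow> nat" where
  "divisor_sum n = (\<Sum>d | d dvd n. d)"

definition perfect :: "nat \<Rightarrow> bool" where
  "perfect n \<longleftrightarrow> n > 0 \<and> divisor_sum n = 2 * n"

end

theory Submission
  imports Defs
begin

text \<open>
  Since \<open>p\<^sup>k\<close> is coprime to \<open>\<sigma>(p\<^sup>k)\<close>, we have \<open>\<sigma>(m\<^sup>2) = s p\<^sup>k\<close> and \<open>s \<sigma>(p\<^sup>k) = 2m\<^sup>2\<close>,
  with \<open>s\<close> odd because \<open>\<sigma>(p\<^sup>k)\<close> is even. So \<open>\<mu>\<^sub>2 = s\<close>, \<open>\<rho>\<^sub>2 = 2/s\<close>, \<open>\<mu>\<^sub>1 = 2/\<rho>\<^sub>1\<close>, and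
  apart from \<open>1 < \<rho>\<^sub>1 < p/(p-1) \<le> 5/4\<close> everything rests on \<open>s \<noteq> 1\<close>.

  Suppose \<open>s = 1\<close>, and let \<open>q\<^sup>a\<close> be the exact power of a prime \<open>q\<close> dividing \<open>m\<close>. Then
  \<open>\<sigma>(q\<^sup>2\<^sup>a)\<close> divides \<open>\<sigma>(m\<^sup>2) = p\<^sup>k\<close>, so it is a power \<open>p\<^sup>b\<close>, and \<open>p\<^sup>b - 1\<close> is divisible by \<open>q\<close>
  exactly once. As \<open>q\<^sup>2\<^sup>a\<close> divides \<open>\<sigma>(p\<^sup>k)\<close> and hence \<open>p\<^bsup>b(k+1)\<^esup> - 1\<close>, lifting the exponent
  gives \<open>q\<^bsup>2a-1\<^esup> | k + 1\<close>. Therefore \<open>m | k + 1\<close>, which is incompatible with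
  \<open>2m\<^sup>2 = \<sigma>(p\<^sup>k) > 5\<^sup>k\<close>.
\<close>

section \<open>Divisor sums of prime powers and of coprime products\<close>

lemma sum_power_atMost_Suc_shift:
  fixes x :: "'a :: comm_semiring_1"
  shows "(\<Sum>i\<le>Suc n. x ^ i) = 1 + x * (\<Sum>i\<le>n. x ^ i)"
  by (simp add: sum.atMost_Suc_shift sum_distrib_left del: sum.atMost_Suc)

lemma divisor_sum_prime_power:
  assumes "prime p"
  shows "divisor_sum (p ^ k) = (\<Sum>i\<le>k. p ^ i)"
proof -
  have "{d. d dvd p ^ k} = (\<lambda>i. p ^ i) ` {..k}"
    using assms by (auto simp: divides_primepow_nat intro: le_imp_power_dvd)
  moreover have "inj_on (\<lambda>i. p ^ i) {..k}"
    using prime_gt_1_nat[OF assms] by (auto intro: inj_onI)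
  ultimately show ?thesis
    by (simp add: divisor_sum_def sum.reindex)
qed

lemma divisor_sum_mult_coprime:
  assumes "coprime a b" "a > 0" "b > 0"
  shows "divisor_sum (a * b) = divisor_sum a * divisor_sum b"
proof -
  let ?D = "\<lambda>n::nat. {d. d dvd n}"
  have img: "?D (a * b) = (\<lambda>(x, y). x * y) ` (?D a \<times> ?D b)"
  proof (intro equalityI subsetI)
    fix d assume "d \<in> ?D (a * b)"
    then obtain x y where "d = x * y" "x dvd a" "y dvd b"
      using division_decomp[of d a b] by auto
    then show "d \<in> (\<lambda>(x, y). x * y) ` (?D a \<times> ?D b)" by auto
  qed (auto intro: mult_dvd_mono)
  have inj: "inj_on (\<lambda>(x, y). x * y) (?D a \<times> ?D b)"
  proof (rule inj_onI, clarsimp)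
    fix x y x' y'
    assume *: "x dvd a" "y dvd b" "x' dvd a" "y' dvd b" "x * y = x' * y'"
    \<comment> \<open>Once the factor coming from \<open>b\<close> is cancelled, \<open>x\<close>
      and \<open>x'\<close> divide each other.\<close>
    have "coprime x y'" "coprime x' y"
      using * assms(1) by (meson coprime_divisors)+
    then have "x dvd x'" "x' dvd x"
      using *(5) by (metis coprime_dvd_mult_left_iff dvd_triv_left)+
    then have "x = x'" by (rule dvd_antisym)
    moreover have "x > 0" using * assms by (auto intro: dvd_pos_nat)
    ultimately show "x = x' \<and> y = y'" using *(5) by auto
  qed
  have "divisor_sum (a * b) = (\<Sum>(x, y)\<in>?D a \<times> ?D b. x * y)"
    unfolding divisor_sum_def img by (subst sum.reindex[OF inj]) (simp add: case_prod_unfold)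
  also have "\<dots> = divisor_sum a * divisor_sum b"
    unfolding divisor_sum_def sum_product by (rule sum.cartesian_product[symmetric])
  finally show ?thesis .
qed

section \<open>Lifting the exponent at an odd prime\<close>

lemma sum_power_cong_card:
  fixes q x :: int
  assumes "q dvd x - 1"
  shows "[(\<Sum>i<n. x ^ i) = int n] (mod q)"
proof -
  have "[(\<Sum>i<n. x ^ i) = (\<Sum>i<n. 1 ^ i)] (mod q)"
    using assms by (intro cong_sum cong_pow) (simp add: cong_iff_dvd_diff)
  then show ?thesis by simp
qed

text \<open>With x = 1 + qz, the binomial expansion gives x^i = 1 + iqz modulo q^2. The linear terms
  add up to qz * q(q-1)/2, a multiple of q^2 because (q-1)/2 is an integer.\<close>

lemma sum_power_cong_square:
  fixes q :: nat and x :: int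
  assumes "odd q" "int q dvd x - 1"
  shows "[(\<Sum>i<q. x ^ i) = int q] (mod (int q)\<^sup>2)"
proof -
  obtain z where z: "x = 1 + int q * z"
    using assms(2) by (metis add.commute diff_add_cancel dvdE)
  have pow: "[x ^ i = 1 + int i * (int q * z)] (mod (int q)\<^sup>2)" for i
  proof (induction i)
    case (Suc i)
    have "[x * x ^ i = x * (1 + int i * (int q * z))] (mod (int q)\<^sup>2)"
      using Suc by (rule cong_scalar_left)
    also have "x * (1 + int i * (int q * z))
        = 1 + int (Suc i) * (int q * z) + (int q)\<^sup>2 * (int i * z\<^sup>2)"
      by (simp add: z algebra_simps power2_eq_square)
    also have "[\<dots> = 1 + int (Suc i) * (int q * z)] (mod (int q)\<^sup>2)"
      by (simp add: cong_iff_dvd_diff)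
    finally show ?case by simp
  qed simp
  have half: "(\<Sum>i<q. int i) = int q * ((int q - 1) div 2)"
  proof -
    have "2 * (\<Sum>i<n. int i) = int n * (int n - 1)" for n
      by (induction n) (auto simp: algebra_simps)
    moreover have "2 * ((int q - 1) div 2) = int q - 1" using assms(1) by simp
    ultimately have "2 * (\<Sum>i<q. int i) = 2 * (int q * ((int q - 1) div 2))"
      by (metis mult.left_commute)
    then show ?thesis by simp
  qed
  have "[(\<Sum>i<q. x ^ i) = (\<Sum>i<q. 1 + int i * (int q * z))] (mod (int q)\<^sup>2)"
    by (intro cong_sum pow)
  also have "(\<Sum>i<q. 1 + int i * (int q * z)) = int q + (\<Sum>i<q. int i) * (int q * z)"
    by (simp add: sum.distrib sum_distrib_right)
  also have "\<dots> = int q + (int q)\<^sup>2 * (((int q - 1) div 2) * z)"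
    by (simp add: half power2_eq_square algebra_simps)
  also have "[\<dots> = int q] (mod (int q)\<^sup>2)"
    by (simp add: cong_iff_dvd_diff)
  finally show ?thesis .
qed

text \<open>Each induction step takes one factor q out of n: passing from x to x^q raises the exact
  power of q in x - 1 from c to c + 1.\<close>

lemma lifting_the_exponent_dvd:
  fixes q n c j :: nat and x :: int
  assumes "prime q" "odd q" "c \<ge> 1"
    and "int q ^ c dvd x - 1" "\<not> int q ^ Suc c dvd x - 1"
    and "int q ^ (c + j) dvd x ^ n - 1"
  shows "q ^ j dvd n"
  using assms(3-)
proof (induction j arbitrary: c x n)
  case (Suc j)
  have q0: "int q \<noteq> 0" and pq: "prime (int q)" using assms(1) by (auto simp: prime_gt_0_nat)
  obtain y where y: "x - 1 = int q ^ c * y" using Suc.prems by (elim dvdE)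
  have ny: "\<not> int q dvd y"
    using Suc.prems(3) unfolding y by (auto simp: mult.commute intro: mult_dvd_mono)
  have q1: "int q dvd x - 1"
    using Suc.prems(1) unfolding y by (auto intro: dvd_mult2)
  \<comment> \<open>The bound of the sum is the outer \<open>i\<close>.\<close>
  have geo: "x ^ i - 1 = int q ^ c * (y * (\<Sum>i<i. x ^ i))" for i
    using power_diff_1_eq[of x i] y by (simp add: mult.assoc)
  have "int q ^ Suc c dvd x ^ n - 1"
    using Suc.prems(4) by (rule power_le_dvd) simp
  then have "int q dvd y * (\<Sum>i<n. x ^ i)"
    unfolding geo using q0 by (simp add: mult.commute)
  then have "int q dvd (\<Sum>i<n. x ^ i)"
    using ny pq by (auto simp: prime_dvd_mult_iff)
  then have "q dvd n"
    using sum_power_cong_card[OF q1, of n] by (simp add: cong_dvd_iff)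
  then obtain n' where n': "n = q * n'" by (elim dvdE)
  have S: "[(\<Sum>i<q. x ^ i) = int q] (mod (int q)\<^sup>2)"
    by (rule sum_power_cong_square[OF assms(2) q1])
  have "int q dvd (\<Sum>i<q. x ^ i)"
    using sum_power_cong_card[OF q1, of q] by (simp add: cong_dvd_iff)
  then obtain t where t: "(\<Sum>i<q. x ^ i) = int q * t" by (elim dvdE)
  \<comment> \<open>The geometric sum of length q has exactly one factor q, so x^q - 1 has exactly c
    + 1.\<close>
  have nt: "\<not> int q dvd t"
  proof
    assume "int q dvd t"
    then have "(int q)\<^sup>2 dvd int q"
      using S unfolding t by (metis cong_dvd_iff dvd_refl mult_dvd_mono power2_eq_square)
    then have "int q dvd 1"
      using q0 by (simp add: power2_eq_square)
    then show False using pq not_prime_unit by blast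
  qed
  have xq: "x ^ q - 1 = int q ^ Suc c * (y * t)"
    unfolding geo t by simp
  have "\<not> int q dvd y * t"
    using ny nt pq by (simp add: prime_dvd_mult_iff)
  then have "\<not> int q ^ Suc (Suc c) dvd x ^ q - 1"
    unfolding xq power_Suc2[of _ "Suc c"] using q0 by simp
  then have "q ^ j dvd n'"
    using Suc.prems(4) unfolding n'
    by (intro Suc.IH[of "Suc c" "x ^ q"]) (simp_all add: xq power_mult)
  then show ?case unfolding n' by simp
qed simp

section \<open>Excluding sigma(m^2) = p^k\<close>

lemma prime_power_dvd_exponent:
  fixes p q a b k :: nat
  assumes "prime q" "odd q" "a \<ge> 1"
    and "divisor_sum (q ^ (2 * a)) = p ^ b"
    and "q ^ (2 * a) dvd divisor_sum (p ^ k)" "prime p"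
  shows "q ^ (2 * a - 1) dvd k + 1"
proof -
  have q0: "int q \<noteq> 0" and q2: "q > 1" using assms(1) by (auto simp: prime_gt_0_nat dest: prime_gt_1_nat)
  \<comment> \<open>Two terms are split off the sum for sigma(q^(2a)), so that p^b - 1 is visible
    modulo q^2.\<close>
  obtain n where n: "2 * a = Suc (Suc n)"
    using assms(3) by (intro that[of "2 * a - 2"]) simp
  define T where "T = (\<Sum>i\<le>n. int q ^ i)"
  have "p ^ b = (\<Sum>i\<le>Suc (Suc n). q ^ i)"
    using divisor_sum_prime_power[OF assms(1), of "2 * a"] assms(4) n by simp
  then have "int (p ^ b) = (\<Sum>i\<le>Suc (Suc n). int q ^ i)"
    by (simp only: of_nat_sum of_nat_power)
  also have "\<dots> = 1 + int q * (1 + int q * T)"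
    unfolding T_def sum_power_atMost_Suc_shift by simp
  finally have pb: "int p ^ b - 1 = int q * (1 + int q * T)" by simp
  have "\<not> int q dvd 1 + int q * T"
    using q2 by (simp add: dvd_add_left_iff)
  then have n2: "\<not> int q ^ Suc 1 dvd int p ^ b - 1"
    unfolding pb using q0 by simp
  have "int q ^ (2 * a) dvd (\<Sum>i\<le>k. int p ^ i)"
    using assms(5) divisor_sum_prime_power[OF assms(6), of k]
    by (metis (mono_tags, lifting) of_nat_dvd_iff of_nat_power of_nat_sum sum.cong)
  then have "int q ^ (2 * a) dvd int p ^ (k + 1) - 1"
    using power_diff_1_eq[of "int p" "k + 1"] by (simp add: lessThan_Suc_atMost)
  \<comment> \<open>It is p^b, not p, that is known to be 1 modulo q; raising to the power b makes
    it the base.\<close>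
  moreover have "int p ^ (k + 1) - 1 dvd (int p ^ (k + 1)) ^ b - 1"
    using power_diff_1_eq[of "int p ^ (k + 1)" b] by simp
  ultimately have "int q ^ (2 * a) dvd (int p ^ b) ^ (k + 1) - 1"
    by (metis dvd_trans mult.commute power_mult)
  then have "int q ^ (1 + (2 * a - 1)) dvd (int p ^ b) ^ (k + 1) - 1"
    using assms(3) by simp
  then show ?thesis
    using pb by (intro lifting_the_exponent_dvd[OF assms(1,2) _ _ n2]) auto
qed

text \<open>Comparing multiplicities prime by prime yields \<open>m dvd k + 1\<close>; growth in k
  then gives the contradiction.\<close>

lemma not_divisor_sum_square_eq_prime_power:
  fixes p k m :: nat
  assumes "prime p" "p \<ge> 5" "k > 0" "odd m"
    and sm: "divisor_sum (m\<^sup>2) = p ^ k" and sp: "divisor_sum (p ^ k) = 2 * m\<^sup>2"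
  shows False
proof -
  have m0: "m > 0" using assms(4) by (simp add: odd_pos)
  have "multiplicity q m \<le> multiplicity q (k + 1)" if q: "prime q" for q
  proof (cases "q dvd m")
    case True
    define a where "a = multiplicity q m"
    have a1: "a \<ge> 1" unfolding a_def using True q m0
      by (intro multiplicity_geI) (auto dest: prime_gt_1_nat)
    obtain r where r: "m = q ^ a * r" "\<not> q dvd r"
      unfolding a_def using multiplicity_decompose'[of m q] q m0 by (metis not_prime_unit neq0_conv)
    have m2: "m\<^sup>2 = q ^ (2 * a) * r\<^sup>2"
      unfolding r(1) by (simp add: power_mult_distrib power_mult[symmetric] mult.commute)
    have "coprime (q ^ (2 * a)) (r\<^sup>2)" using q r(2) by (simp add: prime_imp_coprime)
    then have "divisor_sum (q ^ (2 * a)) * divisor_sum (r\<^sup>2) = p ^ k"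
      using divisor_sum_mult_coprime[of "q ^ (2 * a)" "r\<^sup>2"] sm m0 unfolding m2
      using q r by (auto simp: prime_gt_0_nat)
    then have "divisor_sum (q ^ (2 * a)) dvd p ^ k" by (metis dvd_triv_left)
    then obtain b where b: "divisor_sum (q ^ (2 * a)) = p ^ b"
      using assms(1) by (auto simp: divides_primepow_nat)
    have "odd q" using True assms(4) by (auto intro: dvd_trans)
    moreover have "q ^ (2 * a) dvd divisor_sum (p ^ k)"
      unfolding sp m2 by (intro dvd_mult dvd_mult2) simp
    ultimately have "q ^ (2 * a - 1) dvd k + 1"
      using prime_power_dvd_exponent[OF q _ a1 b _ assms(1)] by blast
    \<comment> \<open>Here 2a - 1 >= a since a >= 1.\<close>
    then have "q ^ a dvd k + 1" by (rule power_le_dvd) (use a1 in simp)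
    then show ?thesis unfolding a_def[symmetric]
      using q by (intro multiplicity_geI) (auto simp: not_prime_unit)
  qed (simp add: not_dvd_imp_multiplicity_0)
  then have "m dvd k + 1"
    using m0 by (intro multiplicity_le_imp_dvd) auto
  moreover have "m \<noteq> 1"
  proof
    assume "m = 1"
    then have "p ^ k = 1" using sm by (simp add: divisor_sum_def)
    then show False using assms by simp
  qed
  \<comment> \<open>This rules out k = 1, where the size estimate fails (5 < 8); from k = 2 on it
    holds (18 < 25).\<close>
  moreover have "m = 1" if "m dvd 2"
    using that assms(4) two_is_prime_nat by (auto simp: prime_nat_iff)
  ultimately have mk: "m \<le> k + 1" and k1: "k \<noteq> 1"
    by (auto dest: dvd_imp_le simp: numeral_2_eq_2)
  have "5 ^ k \<le> p ^ k" using assms(2) by (rule power_mono) simp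
  also have "p ^ k \<le> divisor_sum (p ^ k)"
    unfolding divisor_sum_def using assms(1) by (intro member_le_sum) (auto simp: prime_gt_0_nat)
  also have "\<dots> \<le> 2 * (k + 1)\<^sup>2" unfolding sp using mk by (simp add: power_mono)
  finally have "5 ^ k \<le> 2 * (k + 1)\<^sup>2" .
  moreover have "2 * (k + 1)\<^sup>2 < (5::nat) ^ k" if "k \<ge> 2"
    using that by (induction k rule: dec_induct) (auto simp: power2_eq_square)
  ultimately show False using k1 assms(3) by linarith
qed

section \<open>The bounds on the four ratios\<close>

theorem theorem4p2p3:
  fixes N p k m :: nat
    and \<rho>\<^sub>1 \<rho>\<^sub>2 \<mu>\<^sub>1 \<mu>\<^sub>2 :: real
  assumes "N = p ^ k * m\<^sup>2"
    and "odd N" and "perfect N"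
    and "prime p" and "[p = k] (mod 4)" and "[k = 1] (mod 4)"
    and "k > 0" and "m > 0" and "gcd p m = 1"
  defines "\<rho>\<^sub>1 \<equiv> real (divisor_sum (p ^ k)) / real (p ^ k)"
    and "\<rho>\<^sub>2 \<equiv> real (divisor_sum (p ^ k)) / real (m\<^sup>2)"
    and "\<mu>\<^sub>1 \<equiv> real (divisor_sum (m\<^sup>2)) / real (m\<^sup>2)"
    and "\<mu>\<^sub>2 \<equiv> real (divisor_sum (m\<^sup>2)) / real (p ^ k)"
  shows "(0 < \<rho>\<^sub>2 \<and> \<rho>\<^sub>2 \<le> 2 / 3 \<and> (2 / 3 :: real) < 1 \<and> 1 < \<rho>\<^sub>1 \<and> \<rho>\<^sub>1 < 5 / 4 \<and>
          (5 / 4 :: real) < 8 / 5 \<and> 8 / 5 < \<mu>\<^sub>1 \<and> \<mu>\<^sub>1 < 2 \<and> (2 :: real) < 3 \<and> 3 \<le> \<mu>\<^sub>2) \<and>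
         (57 / 20 < \<rho>\<^sub>1 + \<mu>\<^sub>1 \<and> \<rho>\<^sub>1 + \<mu>\<^sub>1 < 3 \<and> (3 :: real) < 11 / 3 \<and> 11 / 3 \<le> \<rho>\<^sub>2 + \<mu>\<^sub>2)"
proof -
  define A where "A = divisor_sum (p ^ k)"
  define B where "B = divisor_sum (m\<^sup>2)"
  define P where "P = p ^ k"
  have p0: "p > 0" using assms(4) by (rule prime_gt_0_nat)
  have P0: "P > 0" using p0 by (simp add: P_def)
  have podd: "odd p" and modd: "odd m" using assms(1,2,7) by auto
  have "[p = 1] (mod 4)" using assms(5,6) by (rule cong_trans)
  then have "p mod 4 = 1" by (simp add: cong_def)
  then have p5: "p \<ge> 5" using prime_gt_1_nat[OF assms(4)] by presburger
  have "k mod 4 = 1" using assms(6) by (simp add: cong_def)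
  then have kodd: "odd k" by presburger
  have "coprime (p ^ k) (m\<^sup>2)" using gcd_eq_1_imp_coprime[OF assms(9)] by simp
  then have AB: "A * B = 2 * (P * m\<^sup>2)"
    using divisor_sum_mult_coprime[of "p ^ k" "m\<^sup>2"] assms(1,3,8) p0
    by (simp add: A_def B_def P_def perfect_def)
  have Asum: "A = (\<Sum>i\<le>k. p ^ i)"
    unfolding A_def by (rule divisor_sum_prime_power[OF assms(4)])
  obtain l where l: "k = Suc l" using assms(7) by (cases k) auto
  have A1: "A = 1 + p * (\<Sum>i\<le>l. p ^ i)"
    unfolding Asum l by (rule sum_power_atMost_Suc_shift)
  have A2: "A = P + (\<Sum>i\<le>l. p ^ i)"
    unfolding Asum P_def l by simp
  have "\<not> p dvd A"
    unfolding A1 using p5 by (simp only: dvd_add_left_iff dvd_triv_left) simp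
  then have "coprime p A" using assms(4) by (rule prime_imp_coprime[rotated])
  then have "coprime P A" by (simp add: P_def)
  moreover have "P dvd A * B" unfolding AB by simp
  ultimately have "P dvd B" by (simp add: coprime_dvd_mult_right_iff)
  then obtain s where s: "B = P * s" by (elim dvdE)
  have As: "A * s = 2 * m\<^sup>2" using AB P0 unfolding s by simp
  \<comment> \<open>The sum has k + 1 odd terms, an even number of them.\<close>
  have "even A" unfolding Asum using podd kodd by (simp add: even_sum_iff)
  then obtain h where h: "A = 2 * h" by (elim evenE)
  have hs: "h * s = m\<^sup>2" using As h by simp
  then have sodd: "odd s" using modd by (metis even_mult_iff even_power)
  moreover have "s \<noteq> 1"
    using not_divisor_sum_square_eq_prime_power[OF assms(4) p5 assms(7) modd] s As
    by (auto simp: A_def B_def P_def)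
  ultimately have s3: "s \<ge> 3" by presburger
  have PltA: "P < A" unfolding A2 using p0 by (simp add: sum_pos)
  \<comment> \<open>Equating \<open>A1\<close> and \<open>A2\<close> gives (p-1)L = P - 1, hence 4L
    < P.\<close>
  have "4 * A < 5 * P"
  proof -
    define L where "L = (\<Sum>i\<le>l. p ^ i)"
    have "1 + p * L = P + L" using A1 A2 by (simp add: L_def)
    moreover have "5 * L \<le> p * L" using p5 by simp
    ultimately have "4 * L < P"
      by (cases "p * L") auto
    then show ?thesis unfolding A2 L_def[symmetric] by simp
  qed
  have r1: "\<rho>\<^sub>1 = A / P" by (simp add: \<rho>\<^sub>1_def A_def P_def)
  have r1b: "1 < \<rho>\<^sub>1" "\<rho>\<^sub>1 < 5 / 4"
    unfolding r1 using PltA \<open>4 * A < 5 * P\<close> P0 by (auto simp: field_simps)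
  have A0: "A > 0" using PltA by simp
  have AsR: "real A * real s = 2 * real (m\<^sup>2)" using As by (metis of_nat_mult of_nat_numeral)
  have m0: "real (m\<^sup>2) > 0" using assms(8) by simp
  have m2: "\<mu>\<^sub>2 = s"
    using P0 s by (simp add: \<mu>\<^sub>2_def B_def P_def)
  have "\<rho>\<^sub>2 = A / real (m\<^sup>2)" by (simp add: \<rho>\<^sub>2_def A_def)
  also have "\<dots> = 2 / s" using AsR m0 s3 by (simp add: field_simps del: of_nat_power)
  finally have r2: "\<rho>\<^sub>2 = 2 / s" .
  have "\<mu>\<^sub>1 = P * s / real (m\<^sup>2)" using s by (simp add: \<mu>\<^sub>1_def B_def)
  also have "\<dots> = 2 / \<rho>\<^sub>1"
    unfolding r1 using AsR m0 A0 P0 by (simp add: field_simps del: of_nat_power)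
  finally have m1: "\<mu>\<^sub>1 = 2 / \<rho>\<^sub>1" .
  \<comment> \<open>For x > 0, x + 2/x - (u + v) = (x-u)(x-v)/x whenever uv = 2. The pairs (5/4,
    8/5), (1, 2) and (3, 2/3) produce the constants 57/20, 3 and 11/3.\<close>
  have "(\<rho>\<^sub>1 - 5 / 4) * (\<rho>\<^sub>1 - 8 / 5) > 0" using r1b by (intro mult_neg_neg) auto
  then have lo: "57 / 20 < \<rho>\<^sub>1 + \<mu>\<^sub>1" using r1b unfolding m1 by (simp add: field_simps)
  have "(\<rho>\<^sub>1 - 1) * (\<rho>\<^sub>1 - 2) < 0" using r1b by (intro mult_pos_neg) auto
  then have hi: "\<rho>\<^sub>1 + \<mu>\<^sub>1 < 3" using r1b unfolding m1 by (simp add: field_simps)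
  have "(real s - 3) * (real s - 2 / 3) \<ge> 0" using s3 by (intro mult_nonneg_nonneg) auto
  then have hi2: "11 / 3 \<le> \<rho>\<^sub>2 + \<mu>\<^sub>2" using s3 unfolding r2 m2 by (simp add: field_simps)
  have "8 / 5 < \<mu>\<^sub>1" "\<mu>\<^sub>1 < 2" using r1b unfolding m1 by (auto simp: field_simps)
  moreover have "0 < \<rho>\<^sub>2" "\<rho>\<^sub>2 \<le> 2 / 3" "3 \<le> \<mu>\<^sub>2" using s3 unfolding r2 m2 by (auto simp: field_simps)
  ultimately show ?thesis using r1b lo hi hi2 by simp
qed

end
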